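(* Let $G$ be a finite simple graph that is not a complete graph, and let $\phi$ be a semi-transitive orientation of $G$. Then there exist two distinct non-adjacent vertices $u,v\in V(G)$ such that $\phi$ can be extended to a semi-transitive orientation of $G+uv$; that is, there is a semi-transitive orientation of $G+uv$ that agrees with $\phi$ on every edge of $G$.
   Context: Graphs are finite, undirected and simple. An orientation of a graph assigns to each edge one of its two directions; it is acyclic if it has no directed cycle. A digraph is transitive if whenever $v_1\to v_2$ and $v_2\to v_3$ are directed edges on three distinct vertices, $v_1\to v_3$ is also a directed edge. Given an acyclic orientation $\phi$ of a graph $G$, a shortcut in $\phi(G)$ is a non-transitive induced subdigraph of $\phi(G)$ on a vertex set $\{v_1,\dots,v_n\}$ with $n\ge 4$ (distinct vertices) that contains the directed path $v_1\to v_2\to\cdots\to v_n$ and the directed edge $v_1\to v_n$. An acyclic orientation $\phi$ is semi-transitive if $\phi(G)$ contains no shortcut. $G+uv$ denotes the graph obtained from $G$ by adding the edge $uv$. *)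

theory Defs
  imports "Graph_Theory.Graph_Theory"
begin

text \<open>
  A finite simple graph is a \<^locale>\<open>pair_graph\<close>: an undirected edge is a pair of opposite
  arcs. An orientation of \<open>G\<close> is represented by the digraph it produces.
\<close>

definition orientation :: "'a pair_pre_digraph \<Rightarrow> 'a pair_pre_digraph \<Rightarrow> bool" where
  "orientation G D \<longleftrightarrow> pverts D = pverts G \<and> parcs D \<subseteq> parcs G \<and>
     (\<forall>u v. (u, v) \<in> parcs G \<longrightarrow> ((u, v) \<in> parcs D) \<noteq> ((v, u) \<in> parcs D))"

definition acyclic_digraph :: "('a, 'b) pre_digraph \<Rightarrow> bool" where
  "acyclic_digraph D \<longleftrightarrow> \<not> (\<exists>p. pre_digraph.cycle D p)"

definition transitive_digraph :: "('a, 'b) pre_digraph \<Rightarrow> bool" where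
  "transitive_digraph D \<longleftrightarrow>
     (\<forall>v1 v2 v3. distinct [v1, v2, v3] \<and> v1 \<rightarrow>\<^bsub>D\<^esub> v2 \<and> v2 \<rightarrow>\<^bsub>D\<^esub> v3 \<longrightarrow> v1 \<rightarrow>\<^bsub>D\<^esub> v3)"

definition shortcut :: "('a, 'b) pre_digraph \<Rightarrow> ('a, 'b) pre_digraph \<Rightarrow> bool" where
  "shortcut S D \<longleftrightarrow> induced_subgraph S D \<and> \<not> transitive_digraph S \<and>
     (\<exists>vs. length vs \<ge> 4 \<and> verts S = set vs \<and> vpath vs S \<and> hd vs \<rightarrow>\<^bsub>S\<^esub> last vs)"

definition semi_transitive_orientation :: "'a pair_pre_digraph \<Rightarrow> 'a pair_pre_digraph \<Rightarrow> bool" where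
  "semi_transitive_orientation G D \<longleftrightarrow> orientation G D \<and> acyclic_digraph (with_proj D) \<and>
     \<not> (\<exists>S. shortcut S (with_proj D))"

definition add_edge :: "'a pair_pre_digraph \<Rightarrow> 'a \<Rightarrow> 'a \<Rightarrow> 'a pair_pre_digraph" where
  "add_edge G u v = G\<lparr>parcs := parcs G \<union> {(u, v), (v, u)}\<rparr>"

end

theory Submission
  imports Defs
begin

text \<open>
  An acyclic digraph with arc relation \<open>r\<close> has no shortcut iff every arc \<open>(a, b)\<close> spans an
  interval of the reachability order \<open>r\<^sup>*\<close> inside which \<open>r\<close> and \<open>r\<^sup>+\<close> coincide. If
  \<open>r \<noteq> r\<^sup>+\<close>, add a pair \<open>(u, v) \<in> r\<^sup>+ - r\<close> with smallest interval: reachability does not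
  change, and by minimality only \<open>(u, v)\<close> itself was missing between \<open>u\<close> and \<open>v\<close>. If
  \<open>r = r\<^sup>+\<close>, then \<open>r\<close> is a strict partial order, and it stays one when a critical pair of
  incomparable elements is added.
\<close>

definition interval_transitive :: "'a rel \<Rightarrow> bool" where
  "interval_transitive r \<longleftrightarrow>
     (\<forall>a b x y. (a, b) \<in> r \<longrightarrow> (a, x) \<in> r\<^sup>* \<longrightarrow> (x, y) \<in> r\<^sup>+ \<longrightarrow> (y, b) \<in> r\<^sup>* \<longrightarrow> (x, y) \<in> r)"

section \<open>Shortcuts and intervals\<close>

lemma (in wf_digraph) acyclic_digraph_iff: "acyclic_digraph G \<longleftrightarrow> acyclic (arcs_ends G)"
proof
  assume ac: "acyclic_digraph G"
  show "acyclic (arcs_ends G)"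
  proof (rule acyclicI, rule allI, rule notI)
    fix x assume "x \<rightarrow>\<^sup>+ x"
    then obtain p where "awalk x p x" "p \<noteq> []" by (auto simp: reachable1_awalk)
    then have "closed_w p" by (auto simp: closed_w_def)
    then show False using closed_w_imp_cycle ac by (auto simp: acyclic_digraph_def)
  qed
next
  assume ac: "acyclic (arcs_ends G)"
  show "acyclic_digraph G"
    unfolding acyclic_digraph_def
  proof
    assume "\<exists>p. cycle p"
    then obtain u p where "awalk u p u" "p \<noteq> []" by (auto simp: cycle_def)
    then have "u \<rightarrow>\<^sup>+ u" by (auto simp: reachable1_awalk)
    then show False using ac by (auto simp: acyclic_def)
  qed
qed

text \<open>Adjacent entries are arcs and reachability is transitive. This places every vertex of a
  walk between its ends; with acyclicity it gives distinctness, and in a transitive acyclic digraph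
  adjacency of any two entries.\<close>

lemma vwalk_sorted_wrt_trancl:
  "vwalk p G \<Longrightarrow> sorted_wrt (\<lambda>x y. (x, y) \<in> (arcs_ends G)\<^sup>+) p"
proof (induct p rule: vwalk_induct)
  case (Cons u v es)
  have "transp (\<lambda>x y. (x, y) \<in> (arcs_ends G)\<^sup>+)" by (auto intro: transpI)
  then show ?case using Cons by (auto simp: sorted_wrt2 intro: trancl_into_trancl2)
qed simp

lemma vwalk_distinct_if_acyclic:
  assumes "vwalk p G" "acyclic (arcs_ends G)"
  shows "distinct p"
  using vwalk_sorted_wrt_trancl[OF assms(1)] assms(2)
  by (induct p) (auto simp: acyclic_def)

lemma vwalk_hd_reaches:
  assumes "vwalk p G" "x \<in> set p"
  shows "(hd p, x) \<in> (arcs_ends G)\<^sup>*"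
  using vwalk_sorted_wrt_trancl[OF assms(1)] assms(2)
  by (cases p) (auto intro: trancl_into_rtrancl)

lemma vwalk_reaches_last:
  assumes "vwalk p G" "x \<in> set p"
  shows "(x, last p) \<in> (arcs_ends G)\<^sup>*"
  using vwalk_sorted_wrt_trancl[OF assms(1)] assms(2)
  by (cases p rule: rev_cases) (auto simp: sorted_wrt_append intro: trancl_into_rtrancl)

text \<open>The prefix \<open>p\<close> is kept, so repeated use routes one walk through prescribed
  vertices.\<close>

lemma (in wf_digraph) vwalk_extend:
  assumes "vwalk p G" "last p = v" "(v, w) \<in> (arcs_ends G)\<^sup>*"
  shows "\<exists>q. vwalk (p @ q) G \<and> last (p @ q) = w"
  using assms(3)
proof (induct rule: rtrancl_induct)
  case base
  then show ?case using assms(1,2) by (intro exI[of _ "[]"]) simp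
next
  case (step y z)
  then obtain q where q: "vwalk (p @ q) G" "last (p @ q) = y" by auto
  have "vwalk ((p @ q) @ [z]) G"
    using q step(2) by (auto simp: vwalk_def set_vwalk_arcs_snoc simp del: append_assoc)
  then show ?case by (intro exI[of _ "q @ [z]"]) simp
qed

text \<open>\<open>transitive_digraph\<close> speaks of distinct vertices only; acyclicity excludes
  all coincidences.\<close>

lemma transitive_digraph_imp_trans:
  assumes "transitive_digraph G" "acyclic (arcs_ends G)"
  shows "trans (arcs_ends G)"
proof (rule transI)
  fix x y z assume xy: "(x, y) \<in> arcs_ends G" and yz: "(y, z) \<in> arcs_ends G"
  then have "(x, z) \<in> (arcs_ends G)\<^sup>+" by (blast intro: trancl_into_trancl)
  moreover have "(w, w) \<notin> (arcs_ends G)\<^sup>+" for w using assms(2) by (simp add: acyclic_def)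
  ultimately have "distinct [x, y, z]" using xy yz by auto
  then show "(x, z) \<in> arcs_ends G" using assms(1) xy yz unfolding transitive_digraph_def by blast
qed

text \<open>All vertices of a shortcut lie in the interval from \<open>hd vs\<close> to
  \<open>last vs\<close>, which an arc spans. Closure there supplies the arcs that transitivity asks
  for, and they belong to \<open>S\<close> because \<open>S\<close> is induced.\<close>

lemma (in wf_digraph) shortcut_imp_not_interval_transitive:
  assumes "shortcut S G"
  shows "\<not> interval_transitive (arcs_ends G)"
proof
  assume it: "interval_transitive (arcs_ends G)"
  obtain vs where ind: "induced_subgraph S G" and nt: "\<not> transitive_digraph S"
    and vs: "verts S = set vs" "vwalk vs S" "(hd vs, last vs) \<in> arcs_ends S"
    using assms by (auto simp: shortcut_def)
  have sub: "subgraph S G" using ind by auto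
  have le: "arcs_ends S \<subseteq> arcs_ends G" using adj_mono[OF _ sub] by auto
  have walk: "vwalk vs G" using vs(2) sub by (rule vwalkI_subgraph)
  have "transitive_digraph S"
    unfolding transitive_digraph_def
  proof (intro allI impI, elim conjE)
    fix x y z assume xy: "(x, y) \<in> arcs_ends S" and yz: "(y, z) \<in> arcs_ends S"
    interpret S: wf_digraph S using sub by auto
    have "x \<in> set vs" "z \<in> set vs" using S.adj_in_verts(1)[OF xy] S.adj_in_verts(2)[OF yz] vs(1) by simp_all
    moreover have "(x, z) \<in> (arcs_ends G)\<^sup>+"
      using xy yz le by (meson r_into_trancl' subsetD trancl.trancl_into_trancl)
    ultimately have "(x, z) \<in> arcs_ends G"
      using it vs(3) le vwalk_hd_reaches[OF walk] vwalk_reaches_last[OF walk]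
      unfolding interval_transitive_def by blast
    then show "(x, z) \<in> arcs_ends S"
      using ind \<open>x \<in> set vs\<close> \<open>z \<in> set vs\<close> vs(1)
      by (auto simp: induced_subgraph_def subgraph_def compatible_def arcs_ends_conv)
  qed
  with nt show False by simp
qed

text \<open>A path from \<open>a\<close> to \<open>b\<close> through \<open>x\<close> and
  \<open>y\<close> carries the shortcut: \<open>y\<close> is reachable from \<open>x\<close> along
  it, yet the arc \<open>(x, y)\<close> is missing.\<close>

lemma (in wf_digraph) shortcut_if_not_interval_transitive:
  assumes ac: "acyclic (arcs_ends G)" and nit: "\<not> interval_transitive (arcs_ends G)"
  shows "\<exists>S. shortcut S G"
proof -
  let ?r = "arcs_ends G"
  have irr: "(x, x) \<notin> ?r\<^sup>+" for x using ac by (auto simp: acyclic_def)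
  obtain a b x y where ab: "(a, b) \<in> ?r" and ax: "(a, x) \<in> ?r\<^sup>*" and xy: "(x, y) \<in> ?r\<^sup>+"
    and yb: "(y, b) \<in> ?r\<^sup>*" and nxy: "(x, y) \<notin> ?r"
    using nit by (auto simp: interval_transitive_def)
  \<comment> \<open>No path from \<open>x\<close> to \<open>y\<close> is a single arc, so there is
    an interior vertex \<open>z\<close>; it is needed to reach four vertices.\<close>
  obtain z where xz: "(x, z) \<in> ?r" and zy: "(z, y) \<in> ?r\<^sup>+"
    using xy nxy by (metis converse_tranclE)
  have 0: "vwalk [a] G" "last [a] = a" using ab by (auto simp: vwalk_def)
  obtain q1 where 1: "vwalk ([a] @ q1) G" "last ([a] @ q1) = x"
    using vwalk_extend[OF 0 ax] by blast
  obtain q2 where 2: "vwalk (([a] @ q1) @ q2) G" "last (([a] @ q1) @ q2) = z"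
    using vwalk_extend[OF 1 r_into_rtrancl[OF xz]] by blast
  obtain q3 where 3: "vwalk ((([a] @ q1) @ q2) @ q3) G" "last ((([a] @ q1) @ q2) @ q3) = y"
    using vwalk_extend[OF 2 trancl_into_rtrancl[OF zy]] by blast
  obtain q4 where 4: "vwalk (((([a] @ q1) @ q2) @ q3) @ q4) G"
      "last (((([a] @ q1) @ q2) @ q3) @ q4) = b"
    using vwalk_extend[OF 3 yb] by blast
  define vs where "vs = (((([a] @ q1) @ q2) @ q3) @ q4)"
  have walk: "vwalk vs G" and hd: "hd vs = a" and last: "last vs = b"
    using 4 by (simp_all add: vs_def)
  have dist: "distinct vs" using vwalk_distinct_if_acyclic[OF walk ac] .
  have mem: "a \<in> set vs" "x \<in> set vs" "z \<in> set vs" "y \<in> set vs" "b \<in> set vs"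
    using last_in_set[of "[a] @ q1"] last_in_set[of "([a] @ q1) @ q2"]
      last_in_set[of "(([a] @ q1) @ q2) @ q3"] last_in_set[of "((([a] @ q1) @ q2) @ q3) @ q4"]
    unfolding 1(2) 2(2) 3(2) 4(2) by (simp_all add: vs_def, blast+)
  have len: "length vs \<ge> 4"
  proof -
    have neq: "x \<noteq> z" "z \<noteq> y" "x \<noteq> y" using irr xz zy xy by auto
    \<comment> \<open>\<open>(a, b)\<close> is an arc and \<open>(x, y)\<close> is not, so the two
      pairs differ. The end that differs is the fourth vertex, since meeting another of
      \<open>x\<close>, \<open>z\<close>, \<open>y\<close> would close a cycle.\<close>
    consider "a \<noteq> x" | "b \<noteq> y" using ab nxy by auto
    then have "\<exists>w \<in> set vs. w \<notin> {x, z, y}"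
    proof cases
      case 1
      then have ax': "(a, x) \<in> ?r\<^sup>+" using rtranclD[OF ax] by simp
      then show ?thesis
        using 1 by (metis trancl_into_trancl[OF ax' xz] trancl_trans[OF ax' xy] irr mem(1)
            insertE emptyE)
    next
      case 2
      then have yb': "(y, b) \<in> ?r\<^sup>+" using rtranclD[OF yb] by simp
      then show ?thesis
        using 2 by (metis trancl_trans[OF zy yb'] trancl_trans[OF xy yb'] irr mem(5)
            insertE emptyE)
    qed
    then obtain w where w: "w \<in> set vs" "w \<notin> {x, z, y}" by blast
    have "card {w, x, z, y} \<le> card (set vs)" by (rule card_mono) (use w mem in auto)
    moreover have "card {w, x, z, y} = 4" using w neq by auto
    ultimately show ?thesis using dist by (simp add: distinct_card)
  qed
  define S where "S = G \<restriction> set vs"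
  have vS: "verts S = set vs" by (simp add: S_def)
  have aS: "arcs_ends S = {(p, q) \<in> ?r. p \<in> set vs \<and> q \<in> set vs}"
    by (auto simp: S_def arcs_ends_conv)
  have ind: "induced_subgraph S G"
    unfolding S_def using walk by (intro induced_induce) auto
  have walkS: "vwalk vs S"
    using walk arcs_in_vwalk_arcs[of _ vs] by (auto simp: vwalk_def vS aS)
  have "\<not> transitive_digraph S"
  proof
    assume tS: "transitive_digraph S"
    have acS: "acyclic (arcs_ends S)" by (rule acyclic_subset[OF ac]) (auto simp: aS)
    \<comment> \<open>In a transitive \<open>S\<close> reachability is adjacency, so any two path
      vertices are joined by an arc. The order of \<open>x\<close> and \<open>y\<close> on the path
      is not tracked; acyclicity rules out the arc \<open>(y, x)\<close>.\<close>
    then have "sorted_wrt (\<lambda>x y. (x, y) \<in> arcs_ends S) vs"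
      using vwalk_sorted_wrt_trancl[OF walkS] transitive_digraph_imp_trans[OF tS]
      by (simp add: trancl_id)
    moreover obtain i j where ij: "i < length vs" "j < length vs" "vs ! i = x" "vs ! j = y"
      using mem by (auto simp: in_set_conv_nth)
    ultimately have "(x, y) \<in> arcs_ends S \<or> x = y \<or> (y, x) \<in> arcs_ends S"
      by (metis linorder_neqE_nat sorted_wrt_nth_less)
    then have "(y, x) \<in> ?r" using nxy xy irr by (auto simp: aS)
    then show False using xy irr by (meson trancl.trancl_into_trancl)
  qed
  then have "shortcut S G"
    unfolding shortcut_def using ind len vS walkS dist ab mem
    by (intro conjI exI[of _ vs]) (auto simp: hd last aS)
  then show ?thesis ..
qed

text \<open>This reduces the extension problem to one about finite relations.\<close>

lemma semi_transitive_orientation_iff: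
  assumes "wf_digraph (with_proj D)"
  shows "semi_transitive_orientation G D \<longleftrightarrow>
    orientation G D \<and> acyclic (parcs D) \<and> interval_transitive (parcs D)"
proof -
  interpret wf_digraph "with_proj D" by fact
  show ?thesis
    using acyclic_digraph_iff shortcut_if_not_interval_transitive
      shortcut_imp_not_interval_transitive
    by (auto simp: semi_transitive_orientation_def)
qed

section \<open>Adding a pair to the arc relation\<close>

lemma interval_transitive_insert_trancl:
  assumes fin: "finite r" and ac: "acyclic r" and it: "interval_transitive r"
    and ne: "r\<^sup>+ \<noteq> r"
  shows "\<exists>u v. (u, v) \<in> r\<^sup>+ \<and> (u, v) \<notin> r \<and> interval_transitive (insert (u, v) r)"
proof -
  \<comment> \<open>The size of an interval is measured by the pairs of \<open>r\<^sup>+\<close>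
    inside it, so that a strictly smaller interval is detected by the loss of \<open>(u, v)\<close>
    itself.\<close>
  define I where "I = (\<lambda>(u, v). {e \<in> r\<^sup>+. (u, fst e) \<in> r\<^sup>* \<and> (snd e, v) \<in> r\<^sup>*})"
  have finI: "finite (I e)" for e using fin by (auto simp: I_def split: prod.split)
  obtain e0 where "e0 \<in> r\<^sup>+ - r" using ne by auto
  then obtain u v where uv: "(u, v) \<in> r\<^sup>+ - r"
    and min: "\<And>e. e \<in> r\<^sup>+ - r \<Longrightarrow> card (I (u, v)) \<le> card (I e)"
    using ex_has_least_nat[of "\<lambda>e. e \<in> r\<^sup>+ - r" e0 "\<lambda>e. card (I e)"] by auto
  have irr: "(x, x) \<notin> r\<^sup>+" for x using ac by (auto simp: acyclic_def)
  \<comment> \<open>With reachability unchanged, the old arcs span the same intervals as before;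
    only the interval of the new arc remains to be checked.\<close>
  have tr: "(insert (u, v) r)\<^sup>+ = r\<^sup>+"
  proof
    have "insert (u, v) r \<subseteq> r\<^sup>+" using uv by auto
    then show "(insert (u, v) r)\<^sup>+ \<subseteq> r\<^sup>+"
      by (metis trancl_id trans_trancl trancl_mono_subset)
  qed (auto intro: trancl_mono)
  have rt: "(insert (u, v) r)\<^sup>* = r\<^sup>*" by (simp only: rtrancl_trancl_reflcl tr)
  \<comment> \<open>Another missing pair between \<open>u\<close> and \<open>v\<close> would have a
    smaller set \<open>I\<close>, against minimality.\<close>
  have inner: "(x, y) \<in> insert (u, v) r"
    if ux: "(u, x) \<in> r\<^sup>*" and xy: "(x, y) \<in> r\<^sup>+" and yv: "(y, v) \<in> r\<^sup>*" for x y
  proof (rule ccontr)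
    assume n: "(x, y) \<notin> insert (u, v) r"
    have "I (x, y) \<subseteq> I (u, v)" using ux yv by (auto simp: I_def intro: rtrancl_trans)
    moreover have "(u, v) \<in> I (u, v)" using uv by (auto simp: I_def)
    moreover have "(u, v) \<notin> I (x, y)"
    proof
      assume "(u, v) \<in> I (x, y)"
      then have "(x, u) \<in> r\<^sup>*" "(v, y) \<in> r\<^sup>*" by (auto simp: I_def)
      then have "x = u" "y = v"
        using ux yv irr by (metis rtranclD rtrancl_trancl_trancl)+
      then show False using n by simp
    qed
    ultimately have "card (I (x, y)) < card (I (u, v))" using finI by (intro psubset_card_mono) auto
    then show False using min[of "(x, y)"] xy n by auto
  qed
  have "interval_transitive (insert (u, v) r)"
    using inner it unfolding interval_transitive_def tr rt by blast
  then show ?thesis using uv by auto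
qed

text \<open>An incomparable pair minimizing the number of predecessors of \<open>u\<close> plus the number of
  successors of \<open>v\<close> is critical: everything below \<open>u\<close> is below \<open>v\<close>, and everything above
  \<open>v\<close> is above \<open>u\<close>.\<close>

lemma trans_insert_critical_pair:
  assumes fin: "finite r" and tr: "trans r" and irr: "irrefl r"
    and xy: "x \<in> V" "y \<in> V" "x \<noteq> y" "(x, y) \<notin> r" "(y, x) \<notin> r" and rV: "r \<subseteq> V \<times> V"
  shows "\<exists>u \<in> V. \<exists>v \<in> V. u \<noteq> v \<and> (u, v) \<notin> r \<and> (v, u) \<notin> r \<and> trans (insert (u, v) r)"
proof -
  define inc where "inc = (\<lambda>(u, v). u \<in> V \<and> v \<in> V \<and> u \<noteq> v \<and> (u, v) \<notin> r \<and> (v, u) \<notin> r)"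
  define m where "m = (\<lambda>(u, v). card (r\<inverse> `` {u}) + card (r `` {v}))"
  obtain u v where uv: "inc (u, v)" and min: "\<And>e. inc e \<Longrightarrow> m (u, v) \<le> m e"
    using ex_has_least_nat[of inc "(x, y)" m] xy by (auto simp: inc_def)
  have fin1: "finite (r\<inverse> `` {w})" and fin2: "finite (r `` {w})" for w using fin by auto
  \<comment> \<open>Otherwise \<open>(w, v)\<close> is again incomparable, and \<open>w\<close> has
    strictly fewer predecessors than \<open>u\<close>, against minimality. The proof of
    \<open>above\<close> is dual.\<close>
  have below: "(w, v) \<in> r" if w: "(w, u) \<in> r" for w
  proof (rule ccontr)
    assume n: "(w, v) \<notin> r"
    have "inc (w, v)"
      using uv w n rV tr by (auto simp: inc_def dest: transD)
    moreover have "r\<inverse> `` {w} \<subset> r\<inverse> `` {u}"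
      using w tr irr by (auto simp: irrefl_def dest: transD)
    then have "m (w, v) < m (u, v)" using psubset_card_mono[OF fin1] by (simp add: m_def)
    ultimately show False using min by (metis not_le)
  qed
  have above: "(u, w) \<in> r" if w: "(v, w) \<in> r" for w
  proof (rule ccontr)
    assume n: "(u, w) \<notin> r"
    have "inc (u, w)"
      using uv w n rV tr by (auto simp: inc_def dest: transD)
    moreover have "r `` {w} \<subset> r `` {v}"
      using w tr irr by (auto simp: irrefl_def dest: transD)
    then have "m (u, w) < m (u, v)" using psubset_card_mono[OF fin2] by (simp add: m_def)
    ultimately show False using min by (metis not_le)
  qed
  \<comment> \<open>\<open>below\<close> and \<open>above\<close> handle compositions of the new
    pair with an old one; composing it with itself would need \<open>u = v\<close>.\<close>
  have "trans (insert (u, v) r)"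
  proof (rule transI)
    fix a b c assume "(a, b) \<in> insert (u, v) r" "(b, c) \<in> insert (u, v) r"
    moreover have "u \<noteq> v" using uv by (simp add: inc_def)
    ultimately show "(a, c) \<in> insert (u, v) r"
      using below above transD[OF tr] unfolding insert_iff prod.inject by metis
  qed
  then show ?thesis using uv by (auto simp: inc_def)
qed

lemma interval_transitive_if_trans: "trans r \<Longrightarrow> interval_transitive r"
  by (simp add: interval_transitive_def trancl_id)

lemma acyclic_interval_transitive_insert:
  assumes fin: "finite r" and ac: "acyclic r" and it: "interval_transitive r"
    and xy: "x \<in> V" "y \<in> V" "x \<noteq> y" "(x, y) \<notin> r" "(y, x) \<notin> r" and rV: "r \<subseteq> V \<times> V"
  shows "\<exists>u \<in> V. \<exists>v \<in> V. u \<noteq> v \<and> (u, v) \<notin> r \<and> (v, u) \<notin> r \<and>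
    acyclic (insert (u, v) r) \<and> interval_transitive (insert (u, v) r)"
proof (cases "r\<^sup>+ = r")
  case False
  then obtain u v where uv: "(u, v) \<in> r\<^sup>+" "(u, v) \<notin> r" "interval_transitive (insert (u, v) r)"
    using interval_transitive_insert_trancl[OF fin ac it] by blast
  \<comment> \<open>A path back from \<open>v\<close> to \<open>u\<close> would close a cycle. Its
    absence yields \<open>u \<noteq> v\<close>, \<open>(v, u) \<notin> r\<close> and acyclicity
    after the insertion.\<close>
  have nvu: "(v, u) \<notin> r\<^sup>*"
    using uv(1) ac by (metis acyclic_def rtrancl_trancl_trancl)
  have "r\<^sup>+ \<subseteq> V \<times> V" using rV by (rule trancl_subset_Sigma)
  then show ?thesis using uv nvu ac by (intro bexI[of _ u] bexI[of _ v]) auto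
next
  case True
  then have tr: "trans r" by (metis trans_trancl)
  have "irrefl r" using ac True by (auto simp: acyclic_def irrefl_def)
  then obtain u v where uv: "u \<in> V" "v \<in> V" "u \<noteq> v" "(u, v) \<notin> r" "(v, u) \<notin> r"
      "trans (insert (u, v) r)"
    using trans_insert_critical_pair[OF fin tr _ xy rV] by blast
  have "(v, u) \<notin> r\<^sup>*" using uv True by (auto simp: rtrancl_eq_or_trancl)
  then show ?thesis
    using uv ac interval_transitive_if_trans by (intro bexI[of _ u] bexI[of _ v]) auto
qed

theorem theorem1p8:
  fixes G D :: "'a pair_pre_digraph"
  assumes "pair_graph G"
    and "\<not> (\<exists>n. complete_digraph n (with_proj G))"
    and "semi_transitive_orientation G D"
  shows "\<exists>u v D'. u \<in> pverts G \<and> v \<in> pverts G \<and> u \<noteq> v \<and> (u, v) \<notin> parcs G \<and>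
    semi_transitive_orientation (add_edge G u v) D' \<and>
    (\<forall>a b. (a, b) \<in> parcs G \<longrightarrow> ((a, b) \<in> parcs D' \<longleftrightarrow> (a, b) \<in> parcs D))"
proof -
  interpret pair_graph G by fact
  have ori: "orientation G D" using assms(3) by (simp add: semi_transitive_orientation_def)
  then have pD: "pverts D = pverts G" and aD: "parcs D \<subseteq> parcs G"
    and oD: "\<And>u v. (u, v) \<in> parcs G \<Longrightarrow> ((u, v) \<in> parcs D) \<noteq> ((v, u) \<in> parcs D)"
    by (auto simp: orientation_def)
  have sub: "parcs D \<subseteq> pverts G \<times> pverts G" using aD by (auto dest: in_arcsD1 in_arcsD2)
  have wfI: "wf_digraph (with_proj H)" if "parcs H \<subseteq> pverts H \<times> pverts H"
    for H :: "'a pair_pre_digraph"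
    using that by unfold_locales auto
  have fin: "finite (parcs D)" using aD pair_finite_arcs by (rule finite_subset)
  have ac: "acyclic (parcs D)" and it: "interval_transitive (parcs D)"
    using semi_transitive_orientation_iff[OF wfI[of D]] assms(3) sub pD by auto
  have sym: "(v, u) \<in> parcs G" if "(u, v) \<in> parcs G" for u v
    using that pair_sym_arcs by (auto simp: symmetric_def dest: symD)
  \<comment> \<open>If all distinct vertices were adjacent, \<open>G\<close> would be complete on
    \<open>card (pverts G)\<close> vertices.\<close>
  have "\<exists>x y. x \<in> pverts G \<and> y \<in> pverts G \<and> x \<noteq> y \<and> (x, y) \<notin> parcs G"
  proof (rule ccontr)
    assume "\<not> ?thesis"
    then have "parcs G = {(u, v). (u, v) \<in> pverts G \<times> pverts G \<and> u \<noteq> v}"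
      using pair_no_loops by (force dest: in_arcsD1 in_arcsD2)
    then have "complete_digraph (card (pverts G)) (with_proj G)"
      unfolding complete_digraph_def using graph_axioms by simp
    with assms(2) show False by blast
  qed
  then obtain x y where xy: "x \<in> pverts G" "y \<in> pverts G" "x \<noteq> y" "(x, y) \<notin> parcs G" by blast
  then have "(x, y) \<notin> parcs D" "(y, x) \<notin> parcs D" using aD sym by blast+
  then obtain u v where uv: "u \<in> pverts G" "v \<in> pverts G" "u \<noteq> v" "(u, v) \<notin> parcs D"
      "(v, u) \<notin> parcs D" and ins: "acyclic (insert (u, v) (parcs D))"
      "interval_transitive (insert (u, v) (parcs D))"
    using acyclic_interval_transitive_insert[OF fin ac it xy(1-3) _ _ sub] by blast
  \<comment> \<open>Each edge of \<open>G\<close> has a direction in \<open>D\<close>, so a pair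
    missing from \<open>D\<close> both ways is a non-edge of \<open>G\<close>.\<close>
  have nuv: "(u, v) \<notin> parcs G" "(v, u) \<notin> parcs G" using oD uv by blast+
  define D' where "D' = D\<lparr>parcs := insert (u, v) (parcs D)\<rparr>"
  have "orientation (add_edge G u v) D'"
    using pD aD oD uv nuv by (auto simp: orientation_def add_edge_def D'_def)
  moreover have "wf_digraph (with_proj D')"
    using sub uv pD by (intro wfI) (auto simp: D'_def)
  ultimately have "semi_transitive_orientation (add_edge G u v) D'"
    using ins by (simp add: semi_transitive_orientation_iff D'_def)
  moreover have "\<forall>a b. (a, b) \<in> parcs G \<longrightarrow> ((a, b) \<in> parcs D' \<longleftrightarrow> (a, b) \<in> parcs D)"
    using nuv by (auto simp: D'_def)
  ultimately show ?thesis using uv nuv by blast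
qed

end
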